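(* Let $f_i$, $i=1,\dots,n$, be functions on $\mathbb{R}^p$ such that $f(x)=\sum_{i=1}^n f_i(x_i)$, $x=(x_1,\dots,x_n)\in\mathbb{R}^{np}$, is convex. Let $\bar A,\bar B,\bar C,\bar D_v,\bar D_e$ be the weighted matrices of a hybrid communication graph, and suppose the Lagrangian of the problem $$\min_{x,z}\ f(x)\quad\text{subject to}\quad \bar Ax=\bar Bz$$ admits at least one saddle point. If the initial multiplier $\nu^0\in\mathbb{R}^{lp}$ satisfies $\bar B^{\mathsf T}\nu^0=0$, then the ADMM iterations with parameter $\gamma$ for solving this problem can be carried out as $$x^{k+1}=\arg\min_x\ f(x)+\frac\gamma2 x^{\mathsf T}\bar D_v x+x^{\mathsf T}\left(y^k-\gamma\bar C\bar D_e^{-1}\bar C^{\mathsf T}x^k\right),$$ $$y^{k+1}=y^k+\gamma\left(\bar D_v-\bar C\bar D_e^{-1}\bar C^{\mathsf T}\right)x^{k+1},$$ where $y^k=\bar A^{\mathsf T}\nu^k$ is a change of variable.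
   Context: Hybrid communication graph: nodes $\{1,\dots,n\}$ and groups $\mathcal E_1,\dots,\mathcal E_m$, which are nonempty subsets of $\{1,\dots,n\}$ whose union is $\{1,\dots,n\}$. Let $l$ be the number of pairs $(i,j)$ with $i\in\mathcal E_j$, enumerated $k=1,\dots,l$. Let $A\in\mathbb{R}^{l\times n}$ and $B\in\mathbb{R}^{l\times m}$ be the matrices in which, if the $k$-th pair is $(i,j)$, the $k$-th row of $A$ is the $i$-th standard basis row vector and the $k$-th row of $B$ is the $j$-th standard basis row vector. Let $S\in\mathbb{R}^{l\times l}$ be a diagonal matrix with nonzero diagonal entries (the $k$-th edge weight is $S_{kk}^2$). Set $\bar A=SA\otimes I_p$, $\bar B=SB\otimes I_p$, $\bar D_v=\bar A^{\mathsf T}\bar A$, $\bar D_e=\bar B^{\mathsf T}\bar B$, $\bar C=\bar A^{\mathsf T}\bar B$. Here $z\in\mathbb{R}^{mp}$. ADMM with parameter $\gamma>0$: with the augmented Lagrangian $\mathcal L_\gamma(x,z,\nu)=f(x)+\nu^{\mathsf T}(\bar Ax-\bar Bz)+\frac\gamma2\|\bar Ax-\bar Bz\|_2^2$, iterate for $k\ge0$: $x^{k+1}=\arg\min_x\mathcal L_\gamma(x,z^k,\nu^k)$, $z^{k+1}=\arg\min_z\mathcal L_\gamma(x^{k+1},z,\nu^k)$, $\nu^{k+1}=\nu^k+\gamma(\bar Ax^{k+1}-\bar Bz^{k+1})$. The Lagrangian is $f(x)+\nu^{\mathsf T}(\bar Ax-\bar Bz)$.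
   Formalization: The x-update at k=0 is claimed only when z^0 = D_e^{-1} C^T x^0 (barred matrices), a link between the starting points that the text leaves implicit; for unrelated x^0 and z^0 the first step can differ (e.g. A=B=1, f=0, ν^0=0, x^0≠z^0). Steps k≥1 need no condition. *)

theory Defs
  imports "HOL-Analysis.Analysis"
begin

text \<open>
  Nodes, groups, edges and local coordinates are indexed by the finite types 'n, 'm, 'l, 'p.
  An edge enumeration is a bijection from 'l onto the set of pairs (i, j) with i in the group j.
  A stacked vector in R^(np) has type real ^ ('n * 'p), its entry (i, a) being the a-th
  coordinate of the i-th block.
\<close>

definition node_matrix :: "('l::finite \<Rightarrow> 'n::finite \<times> 'm::finite) \<Rightarrow> real^'n^'l" where
  "node_matrix e = (\<chi> k. axis (fst (e k)) 1)"

definition group_matrix :: "('l::finite \<Rightarrow> 'n::finite \<times> 'm::finite) \<Rightarrow> real^'m^'l" where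
  "group_matrix e = (\<chi> k. axis (snd (e k)) 1)"

definition kronecker ::
  "real^'n::finite^'l::finite \<Rightarrow> real^'q::finite^'p::finite \<Rightarrow> real^('n \<times> 'q)^('l \<times> 'p)" where
  "kronecker M N = (\<chi> r c. M $ fst r $ fst c * N $ snd r $ snd c)"

definition block :: "real^('n::finite \<times> 'p::finite) \<Rightarrow> 'n \<Rightarrow> real^'p" where
  "block x i = (\<chi> a. x $ (i, a))"

definition separable_sum ::
  "('n::finite \<Rightarrow> real^'p::finite \<Rightarrow> real) \<Rightarrow> real^('n \<times> 'p) \<Rightarrow> real" where
  "separable_sum f x = (\<Sum>i\<in>UNIV. f i (block x i))"

definition lagrangian ::
  "(real^'a::finite \<Rightarrow> real) \<Rightarrow> real^'a^'c::finite \<Rightarrow> real^'b::finite^'c \<Rightarrow>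
    real^'a \<Rightarrow> real^'b \<Rightarrow> real^'c \<Rightarrow> real" where
  "lagrangian F A B x z \<nu> = F x + \<nu> \<bullet> (A *v x - B *v z)"

definition is_saddle_point ::
  "('x \<Rightarrow> 'z \<Rightarrow> 'd \<Rightarrow> real) \<Rightarrow> 'x \<Rightarrow> 'z \<Rightarrow> 'd \<Rightarrow> bool" where
  "is_saddle_point L x z \<nu> \<longleftrightarrow>
     (\<forall>\<nu>'. L x z \<nu>' \<le> L x z \<nu>) \<and> (\<forall>x' z'. L x z \<nu> \<le> L x' z' \<nu>)"

definition augmented_lagrangian ::
  "(real^'a::finite \<Rightarrow> real) \<Rightarrow> real^'a^'c::finite \<Rightarrow> real^'b::finite^'c \<Rightarrow> real \<Rightarrow>
    real^'a \<Rightarrow> real^'b \<Rightarrow> real^'c \<Rightarrow> real" where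
  "augmented_lagrangian F A B \<gamma> x z \<nu> =
     F x + \<nu> \<bullet> (A *v x - B *v z) + \<gamma> / 2 * (norm (A *v x - B *v z))\<^sup>2"

text \<open>
  The value x 0 does not enter the iteration: a run is determined by z 0 and \<open>\<nu>\<close> 0.
\<close>

definition admm_iterates ::
  "(real^'a::finite \<Rightarrow> real) \<Rightarrow> real^'a^'c::finite \<Rightarrow> real^'b::finite^'c \<Rightarrow> real \<Rightarrow>
    (nat \<Rightarrow> real^'a) \<Rightarrow> (nat \<Rightarrow> real^'b) \<Rightarrow> (nat \<Rightarrow> real^'c) \<Rightarrow> bool" where
  "admm_iterates F A B \<gamma> x z \<nu> \<longleftrightarrow> (\<forall>k.
     is_arg_min (\<lambda>u. augmented_lagrangian F A B \<gamma> u (z k) (\<nu> k)) (\<lambda>_. True) (x (Suc k)) \<and>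
     is_arg_min (\<lambda>w. augmented_lagrangian F A B \<gamma> (x (Suc k)) w (\<nu> k)) (\<lambda>_. True) (z (Suc k)) \<and>
     \<nu> (Suc k) = \<nu> k + \<gamma> *\<^sub>R (A *v x (Suc k) - B *v z (Suc k)))"

definition reduced_x_step ::
  "(real^'a::finite \<Rightarrow> real) \<Rightarrow> real^'a^'a \<Rightarrow> real^'b::finite^'b \<Rightarrow> real^'b^'a \<Rightarrow> real \<Rightarrow>
    real^'a \<Rightarrow> real^'a \<Rightarrow> real^'a \<Rightarrow> bool" where
  "reduced_x_step F Dv De C \<gamma> x y x' \<longleftrightarrow>
     is_arg_min (\<lambda>u. F u + \<gamma> / 2 * (u \<bullet> (Dv *v u))
                   + u \<bullet> (y - \<gamma> *\<^sub>R ((C ** matrix_inv De ** transpose C) *v x)))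
       (\<lambda>_. True) x'"

definition reduced_y_step ::
  "real^'a::finite^'a \<Rightarrow> real^'b::finite^'b \<Rightarrow> real^'b^'a \<Rightarrow> real \<Rightarrow>
    real^'a \<Rightarrow> real^'a \<Rightarrow> real^'a \<Rightarrow> bool" where
  "reduced_y_step Dv De C \<gamma> y x' y' \<longleftrightarrow>
     y' = y + \<gamma> *\<^sub>R ((Dv - C ** matrix_inv De ** transpose C) *v x')"

end

theory Submission
  imports Defs
begin

text \<open>
  If \<open>B\<^sup>T \<nu> = 0\<close>, the z-step is a least squares problem, with solution
  \<open>z = D\<^sub>e\<^sup>-\<^sup>1 C\<^sup>T x\<close> because B has full column rank (no group is empty). Its normal
  equation says that the constraint residual is orthogonal to the range of B, so the multiplier
  update preserves \<open>B\<^sup>T \<nu> = 0\<close>. Substituting this z into the x-step and multiplying the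
  multiplier update by \<open>A\<^sup>T\<close> gives the reduced iteration. Its x-step has exactly one solution:
  every node lies in a group, so A has full column rank and the objective is strictly convex, and
  it is coercive since the saddle point yields an affine minorant of f.
\<close>

section \<open>Gram matrices and normal equations\<close>

lemma inner_matrix_vector_mult_transpose:
  fixes A :: "real^'a::finite^'c::finite"
  shows "u \<bullet> (A *v x) = (transpose A *v u) \<bullet> x"
  by (simp add: dot_lmul_matrix)

text \<open>A kernel vector \<open>x\<close> of the Gram matrix satisfies
  \<open>(B *v x) \<bullet> (B *v x) = 0\<close>, so injectivity of \<open>B\<close> forces
  \<open>x = 0\<close>; a square matrix with trivial kernel is invertible.\<close>

lemma invertible_gram_matrix:
  fixes B :: "real^'b::finite^'c::finite"
  assumes "inj ((*v) B)"
  shows "invertible (transpose B ** B)"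
proof -
  have "x = 0" if "(transpose B ** B) *v x = 0" for x
  proof -
    have "(B *v x) \<bullet> (B *v x) = (transpose B *v (B *v x)) \<bullet> x"
      by (rule inner_matrix_vector_mult_transpose)
    also have "\<dots> = 0"
      using that by (simp only: matrix_vector_mul_assoc inner_zero_left)
    finally have "B *v x = B *v 0" by simp
    then show ?thesis using assms by (simp only: inj_eq)
  qed
  then show ?thesis
    by (auto simp: invertible_left_inverse matrix_left_invertible_ker)
qed

lemma gram_matrix_inv:
  fixes B :: "real^'b::finite^'c::finite"
  assumes "inj ((*v) B)"
  shows "(transpose B ** B) *v (matrix_inv (transpose B ** B) *v w) = w"
proof -
  \<comment> \<open>\<open>matrix_inv\<close> is a chosen two-sided inverse, so its defining
    property follows from invertibility.\<close>
  have "(transpose B ** B) ** matrix_inv (transpose B ** B) = mat 1"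
    using someI_ex[OF invertible_gram_matrix[OF assms, unfolded invertible_def]]
    unfolding matrix_inv_def by blast
  then show ?thesis by (simp only: matrix_vector_mul_assoc matrix_vector_mul_lid)
qed

text \<open>Transposing \<open>transpose A ** B\<close> gives \<open>transpose B ** A\<close>; the
  Gram matrix then cancels its inverse and two copies of \<open>transpose B *v (A *v x)\<close> are
  subtracted.\<close>

lemma least_squares_normal_equation:
  fixes A :: "real^'a::finite^'c::finite" and B :: "real^'b::finite^'c"
  assumes "inj ((*v) B)"
  shows "transpose B *v (A *v x -
    B *v ((matrix_inv (transpose B ** B) ** transpose (transpose A ** B)) *v x)) = 0"
  using gram_matrix_inv[OF assms, of "(transpose B ** A) *v x"]
  by (simp only: matrix_transpose_mul transpose_transpose matrix_vector_mul_assoc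
      matrix_mul_assoc matrix_vector_mult_diff_distrib diff_self)

section \<open>The ADMM steps rewritten in reduced form\<close>

lemma is_arg_min_iff_of_diff_const:
  fixes f g :: "'a \<Rightarrow> 'b::linordered_ab_group_add"
  assumes "\<And>x. f x = g x + c"
  shows "is_arg_min f P x \<longleftrightarrow> is_arg_min g P x"
  by (simp add: is_arg_min_def assms)

text \<open>By the normal equation the residual at \<open>w0\<close> is orthogonal to the range of
  \<open>B\<close>. Pythagoras then shows that moving to \<open>w\<close> costs
  \<open>\<gamma> / 2 * (norm (B *v (w0 - w)))\<^sup>2\<close>, which vanishes only at
  \<open>w0\<close>.\<close>

lemma is_arg_min_least_squares_iff:
  fixes B :: "real^'b::finite^'c::finite"
  assumes B: "inj ((*v) B)" and g: "\<gamma> > 0"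
    and w0: "transpose B *v (b - B *v w0) = 0"
  shows "is_arg_min (\<lambda>w. \<gamma> / 2 * (norm (b - B *v w))\<^sup>2) (\<lambda>_. True) w \<longleftrightarrow> w = w0"
proof -
  have pyth: "(norm (b - B *v w))\<^sup>2 = (norm (b - B *v w0))\<^sup>2 + (norm (B *v (w0 - w)))\<^sup>2" for w
  proof -
    have "orthogonal (b - B *v w0) (B *v (w0 - w))"
      using w0 unfolding orthogonal_def inner_matrix_vector_mult_transpose by simp
    moreover have "b - B *v w = (b - B *v w0) + B *v (w0 - w)"
      by (simp add: matrix_vector_mult_diff_distrib)
    ultimately show ?thesis by (metis norm_add_Pythagorean)
  qed
  have zero: "B *v (w0 - w) = 0 \<longleftrightarrow> w = w0" for w
    using inj_eq[OF B, of "w0 - w" 0] by auto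
  show ?thesis
  proof
    assume "is_arg_min (\<lambda>w. \<gamma> / 2 * (norm (b - B *v w))\<^sup>2) (\<lambda>_. True) w"
    then have "\<gamma> / 2 * (norm (b - B *v w))\<^sup>2 \<le> \<gamma> / 2 * (norm (b - B *v w0))\<^sup>2"
      by (simp add: is_arg_min_linorder)
    then have "(norm (B *v (w0 - w)))\<^sup>2 \<le> 0" using g pyth[of w] by simp
    then show "w = w0" using zero by simp
  next
    assume "w = w0"
    moreover have "(norm (b - B *v w0))\<^sup>2 \<le> (norm (b - B *v w))\<^sup>2" for w
      using pyth[of w] by simp
    ultimately show "is_arg_min (\<lambda>w. \<gamma> / 2 * (norm (b - B *v w))\<^sup>2) (\<lambda>_. True) w"
      using g by (simp add: is_arg_min_linorder)
  qed
qed

text \<open>Orthogonality of \<open>\<nu>\<close> to the range of \<open>B\<close> removes the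
  multiplier term in \<open>w\<close>; what remains is a least squares objective plus a
  constant.\<close>

lemma admm_z_step_iff:
  fixes A :: "real^'a::finite^'c::finite" and B :: "real^'b::finite^'c"
  assumes B: "inj ((*v) B)" and g: "\<gamma> > 0" and nu: "transpose B *v \<nu> = 0"
  shows "is_arg_min (\<lambda>w. augmented_lagrangian F A B \<gamma> x w \<nu>) (\<lambda>_. True) w \<longleftrightarrow>
    w = (matrix_inv (transpose B ** B) ** transpose (transpose A ** B)) *v x"
proof -
  let ?w = "(matrix_inv (transpose B ** B) ** transpose (transpose A ** B)) *v x"
  have "augmented_lagrangian F A B \<gamma> x w \<nu> =
      \<gamma> / 2 * (norm (A *v x - B *v w))\<^sup>2 + (F x + \<nu> \<bullet> (A *v x))" for w
    using nu unfolding augmented_lagrangian_def inner_diff_right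
      inner_matrix_vector_mult_transpose[of _ B] by simp
  note * = is_arg_min_iff_of_diff_const[OF this]
  show ?thesis unfolding * by (rule is_arg_min_least_squares_iff[OF B g least_squares_normal_equation[OF B]])
qed

text \<open>This is the invariant of the iteration: the update adds a multiple of a least squares
  residual, which \<open>transpose B\<close> annihilates.\<close>

lemma multiplier_update_orthogonal:
  fixes A :: "real^'a::finite^'c::finite" and B :: "real^'b::finite^'c"
  assumes B: "inj ((*v) B)" and nu: "transpose B *v \<nu> = 0"
  shows "transpose B *v (\<nu> + \<gamma> *\<^sub>R (A *v x -
    B *v ((matrix_inv (transpose B ** B) ** transpose (transpose A ** B)) *v x))) = 0"
  using nu least_squares_normal_equation[OF B, of A x]
  by (simp only: matrix_vector_right_distrib matrix_vector_mult_scaleR scaleR_zero_right add_0)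

text \<open>Expanding the squared norm, the cross term of \<open>A *v u\<close> and
  \<open>B *v z\<close> becomes the linear correction involving \<open>C\<close>, and the terms free
  of \<open>u\<close> form a constant.\<close>

lemma admm_x_step_iff_reduced_x_step:
  fixes A :: "real^'a::finite^'c::finite" and B :: "real^'b::finite^'c"
  assumes z: "z = (matrix_inv De ** transpose C) *v x"
    and C: "C = transpose A ** B"
  shows "is_arg_min (\<lambda>u. augmented_lagrangian F A B \<gamma> u z \<nu>) (\<lambda>_. True) x' \<longleftrightarrow>
    reduced_x_step F (transpose A ** A) De C \<gamma> x (transpose A *v \<nu>) x'"
proof -
  have Cz: "(C ** matrix_inv De ** transpose C) *v x = transpose A *v (B *v z)"
    by (simp only: z C matrix_vector_mul_assoc matrix_mul_assoc)
  have adj: "u \<bullet> (transpose A *v v) = (A *v u) \<bullet> v" for u v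
    by (simp only: inner_matrix_vector_mult_transpose transpose_transpose)
  have "augmented_lagrangian F A B \<gamma> u z \<nu> =
      F u + \<gamma> / 2 * (u \<bullet> ((transpose A ** A) *v u)) +
      u \<bullet> (transpose A *v \<nu> - \<gamma> *\<^sub>R ((C ** matrix_inv De ** transpose C) *v x)) +
      (\<gamma> / 2 * (norm (B *v z))\<^sup>2 - \<nu> \<bullet> (B *v z))" for u
    unfolding augmented_lagrangian_def Cz
    unfolding inner_diff_right inner_scaleR_right
      matrix_vector_mul_assoc[symmetric] adj power2_norm_eq_inner inner_diff_left
    by (simp add: inner_commute algebra_simps)
  from is_arg_min_iff_of_diff_const[OF this] show ?thesis
    unfolding reduced_x_step_def .
qed

lemma reduced_y_step_multiplier_update:
  fixes A :: "real^'a::finite^'c::finite" and B :: "real^'b::finite^'c"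
  assumes C: "C = transpose A ** B"
  shows "reduced_y_step (transpose A ** A) De C \<gamma> (transpose A *v \<nu>) x y' \<longleftrightarrow>
    y' = transpose A *v (\<nu> + \<gamma> *\<^sub>R (A *v x - B *v ((matrix_inv De ** transpose C) *v x)))"
  unfolding reduced_y_step_def C matrix_vector_mult_diff_rdistrib matrix_vector_right_distrib
    matrix_vector_mult_scaleR matrix_vector_mult_diff_distrib matrix_vector_mul_assoc matrix_mul_assoc ..

section \<open>Coercivity, strict convexity and full column rank\<close>

lemma ex_arg_min_coercive:
  fixes G :: "'a::euclidean_space \<Rightarrow> real"
  assumes cont: "continuous_on UNIV G" and a: "a > 0"
    and lower: "\<And>u. G u \<ge> c - K * norm u + a * (norm u)\<^sup>2"
  shows "\<exists>u. \<forall>v. G u \<le> G v"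
proof -
  \<comment> \<open>Beyond this radius \<open>a * norm v - K\<close> is at least
    \<open>\<bar>G 0 - c\<bar>\<close>. The lower bound 1 on \<open>R\<close> allows multiplication
    by \<open>norm v\<close> below.\<close>
  define R where "R = max 1 ((K + \<bar>G 0 - c\<bar>) / a)"
  have R: "R \<ge> 1" "K + \<bar>G 0 - c\<bar> \<le> a * R"
    using a by (auto simp: R_def field_simps max_def)
  obtain u where u: "\<And>v. v \<in> cball 0 R \<Longrightarrow> G u \<le> G v"
  proof -
    have "compact (cball (0::'a) R)" "cball (0::'a) R \<noteq> {}" "continuous_on (cball 0 R) G"
      using R(1) continuous_on_subset[OF cont] by auto
    from continuous_attains_inf[OF this] show thesis using that by metis
  qed
  have "G u \<le> G v" for v
  proof (cases "norm v \<le> R")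
    case False
    have "\<bar>G 0 - c\<bar> \<le> a * norm v - K"
      using R False a mult_left_mono[of R "norm v" a] by linarith
    \<comment> \<open>The nonnegative right side is multiplied by \<open>norm v \<ge> 1\<close>,
      which makes it the quadratic lower bound of \<open>G v\<close> minus \<open>c\<close>.\<close>
    then have "1 * \<bar>G 0 - c\<bar> \<le> norm v * (a * norm v - K)"
      using R False by (intro mult_mono) auto
    then have "G 0 \<le> G v" using lower[of v] by (simp add: algebra_simps power2_eq_square)
    moreover have "G u \<le> G 0" using u R by simp
    ultimately show ?thesis by simp
  qed (use u in simp)
  then show ?thesis by blast
qed

text \<open>Injectivity bounds \<open>norm (A *v u)\<close> below by a positive multiple of
  \<open>norm u\<close>, so the quadratic term dominates the affine ones and a minimizer exists. It
  also makes the quadratic term strictly convex, which gives uniqueness.\<close>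

lemma ex1_arg_min_convex_plus_quadratic:
  fixes A :: "real^'a::finite^'c::finite"
  assumes F: "convex_on UNIV F" and A: "inj ((*v) A)" and g: "\<gamma> > 0"
    and minorant: "\<And>u. F u \<ge> c + u \<bullet> d"
  shows "\<exists>!x. is_arg_min (\<lambda>u. F u + \<gamma> / 2 * (norm (A *v u))\<^sup>2 + u \<bullet> v) (\<lambda>_. True) x"
proof -
  define G where "G = (\<lambda>u. F u + \<gamma> / 2 * (norm (A *v u))\<^sup>2 + u \<bullet> v)"
  obtain b where b: "b > 0" "\<And>u. b * norm u \<le> norm (A *v u)"
    using linear_inj_bounded_below_pos[of "(*v) A"] A by (auto simp: matrix_vector_mul_linear)
  have "continuous_on UNIV F" using F by (intro convex_on_continuous) auto
  then have cont: "continuous_on UNIV G"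
    unfolding G_def by (intro continuous_intros matrix_vector_mult_linear_continuous_on)
  have "G u \<ge> c - norm (d + v) * norm u + (\<gamma> / 2 * b\<^sup>2) * (norm u)\<^sup>2" for u
  proof -
    have "(b * norm u)\<^sup>2 \<le> (norm (A *v u))\<^sup>2" using b by (intro power_mono) auto
    then have "\<gamma> / 2 * (b * norm u)\<^sup>2 \<le> \<gamma> / 2 * (norm (A *v u))\<^sup>2"
      using g by (intro mult_left_mono) auto
    moreover have "- (norm u * norm (d + v)) \<le> u \<bullet> (d + v)"
      using Cauchy_Schwarz_ineq2[of u "d + v"] by linarith
    ultimately show ?thesis using minorant[of u]
      by (simp add: G_def inner_add_right power_mult_distrib mult.commute mult.left_commute)
  qed
  from ex_arg_min_coercive[OF cont _ this] obtain x where x: "\<And>u. G x \<le> G u"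
    using g b by auto
  have "w = x" if w: "\<And>u. G w \<le> G u" for w
  proof -
    \<comment> \<open>At the midpoint of two minimizers, convexity of \<open>F\<close> and the
      parallelogram law give a decrease of
      \<open>\<gamma> / 8 * (norm (A *v (w - x)))\<^sup>2\<close>, which must therefore be
      zero.\<close>
    define m where "m = (1/2) *\<^sub>R w + (1/2) *\<^sub>R x"
    have "F m \<le> F w / 2 + F x / 2"
      using convex_onD[OF F, of "1/2" w x] by (simp add: m_def)
    moreover have "(norm (A *v m))\<^sup>2 =
        (norm (A *v w))\<^sup>2 / 2 + (norm (A *v x))\<^sup>2 / 2 - (norm (A *v (w - x)))\<^sup>2 / 4"
      by (simp add: m_def matrix_vector_right_distrib matrix_vector_mult_scaleR
          matrix_vector_mult_diff_distrib power2_norm_eq_inner inner_simps inner_commute field_simps)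
    from arg_cong[OF this, of "(*) (\<gamma> / 2)"] have "\<gamma> / 2 * (norm (A *v m))\<^sup>2 = (\<gamma> / 2 * (norm (A *v w))\<^sup>2) / 2 +
        (\<gamma> / 2 * (norm (A *v x))\<^sup>2) / 2 - \<gamma> / 8 * (norm (A *v (w - x)))\<^sup>2"
      by (simp add: algebra_simps)
    moreover have "m \<bullet> v = (w \<bullet> v) / 2 + (x \<bullet> v) / 2"
      by (simp add: m_def inner_simps)
    ultimately have "G m \<le> G w / 2 + G x / 2 - \<gamma> / 8 * (norm (A *v (w - x)))\<^sup>2"
      unfolding G_def by argo
    then have "\<gamma> / 8 * (norm (A *v (w - x)))\<^sup>2 \<le> 0" using w[of m] x[of m] by argo
    then have "A *v (w - x) = A *v 0"
      using g by (simp add: mult_le_0_iff)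
    then show ?thesis using inj_eq[OF A, of "w - x" 0] by auto
  qed
  then have "\<exists>!w. \<forall>u. G w \<le> G u" using x by blast
  then show ?thesis by (simp add: is_arg_min_linorder G_def)
qed

text \<open>With \<open>z\<close> and \<open>\<nu>\<close> frozen at the saddle point, minimality in
  the first variable is the desired bound once the common term in \<open>B *v z\<close>
  cancels.\<close>

lemma saddle_point_affine_minorant:
  fixes A :: "real^'a::finite^'c::finite"
  assumes "is_saddle_point (lagrangian F A B) x z \<nu>"
  obtains c d where "\<And>u. F u \<ge> c + u \<bullet> d"
proof
  show "F u \<ge> (F x + \<nu> \<bullet> (A *v x)) + u \<bullet> (- (transpose A *v \<nu>))" for u
  proof -
    have "lagrangian F A B x z \<nu> \<le> lagrangian F A B u z \<nu>"
      using assms by (simp add: is_saddle_point_def)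
    then show ?thesis
      unfolding lagrangian_def inner_diff_right inner_matrix_vector_mult_transpose[of _ A]
      by (simp add: inner_commute)
  qed
qed

text \<open>Row \<open>(k, a)\<close> reads off the coordinate \<open>(h k, a)\<close> scaled by a
  nonzero weight; as \<open>h\<close> is surjective, every coordinate can be recovered. Both
  \<open>Abar\<close> and \<open>Bbar\<close> have this form.\<close>

lemma inj_kronecker_weighted_selection:
  fixes S :: "real^'l::finite^'l" and h :: "'l \<Rightarrow> 'n::finite"
  assumes diag: "\<forall>k k'. k \<noteq> k' \<longrightarrow> S $ k $ k' = 0" and nz: "\<forall>k. S $ k $ k \<noteq> 0"
    and h: "surj h"
  shows "inj ((*v) (kronecker (S ** (\<chi> k. axis (h k) 1)) (mat 1 :: real^'p::finite^'p)))"
proof (rule injI)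
  fix x y :: "real^('n \<times> 'p)"
  let ?M = "kronecker (S ** (\<chi> k. axis (h k) 1)) (mat 1 :: real^'p^'p)"
  have SM: "(S ** (\<chi> k. axis (h k) 1)) $ k $ i = (if i = h k then S $ k $ k else 0)" for k i
  proof -
    have "(S ** (\<chi> k. axis (h k) 1)) $ k $ i = (\<Sum>k'\<in>UNIV. S $ k $ k' * axis (h k') 1 $ i)"
      by (simp add: matrix_matrix_mult_def)
    also have "\<dots> = (\<Sum>k'\<in>UNIV. if k' = k then S $ k $ k * axis (h k) 1 $ i else 0)"
    proof (rule sum.cong)
      show "S $ k $ k' * axis (h k') 1 $ i = (if k' = k then S $ k $ k * axis (h k) 1 $ i else 0)" for k'
        using diag by (cases "k' = k") simp_all
    qed simp
    finally show ?thesis by (simp add: axis_def)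
  qed
  have entry: "(?M *v x) $ (k, a) = S $ k $ k * x $ (h k, a)" for x :: "real^('n \<times> 'p)" and k a
  proof -
    have "(?M *v x) $ (k, a) = (\<Sum>c\<in>UNIV. if c = (h k, a) then S $ k $ k * x $ c else 0)"
    proof -
      have "?M $ (k, a) $ c * x $ c = (if c = (h k, a) then S $ k $ k * x $ c else 0)" for c
        by (cases c) (auto simp: kronecker_def SM mat_def)
      then show ?thesis by (simp add: matrix_vector_mult_def)
    qed
    then show ?thesis by simp
  qed
  assume eq: "?M *v x = ?M *v y"
  have "x $ (i, a) = y $ (i, a)" for i a
  proof -
    obtain k where "i = h k" using h by (auto simp: surj_def)
    then show ?thesis using entry[of x k a] entry[of y k a] eq nz by simp
  qed
  then show "x = y" by (simp add: vec_eq_iff)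
qed

text \<open>The equivalence is read in both directions: ADMM runs yield reduced steps, reduced runs
  lift to ADMM runs with the same \<open>x\<close>, and the reduced argmin is well defined. Since
  ADMM never reads \<open>x 0\<close>, the first reduced x-step requires \<open>x 0\<close> to be
  compatible with \<open>z 0\<close>.\<close>

theorem proposition2:
  fixes E :: "'m::finite \<Rightarrow> 'n::finite set"
    and e :: "'l::finite \<Rightarrow> 'n \<times> 'm"
    and S :: "real^'l^'l"
    and f :: "'n \<Rightarrow> real^'p::finite \<Rightarrow> real"
    and Abar :: "real^('n \<times> 'p)^('l \<times> 'p)"
    and Bbar :: "real^('m \<times> 'p)^('l \<times> 'p)"
    and Cbar :: "real^('m \<times> 'p)^('n \<times> 'p)"
    and Dv :: "real^('n \<times> 'p)^('n \<times> 'p)"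
    and De :: "real^('m \<times> 'p)^('m \<times> 'p)"
    and \<gamma> :: real
    and \<nu>0 :: "real^('l \<times> 'p)"
  assumes groups_nonempty: "\<forall>j. E j \<noteq> {}"
    and groups_cover: "(\<Union>j. E j) = UNIV"
    and edges: "bij_betw e UNIV {(i, j). i \<in> E j}"
    and S_diagonal: "\<forall>k k'. k \<noteq> k' \<longrightarrow> S $ k $ k' = 0"
    and S_nonzero: "\<forall>k. S $ k $ k \<noteq> 0"
    and Abar: "Abar = kronecker (S ** node_matrix e) (mat 1 :: real^'p^'p)"
    and Bbar: "Bbar = kronecker (S ** group_matrix e) (mat 1 :: real^'p^'p)"
    and Dv: "Dv = transpose Abar ** Abar"
    and De: "De = transpose Bbar ** Bbar"
    and Cbar: "Cbar = transpose Abar ** Bbar"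
    and f_convex: "convex_on UNIV (separable_sum f)"
    and saddle: "\<exists>x z \<nu>. is_saddle_point (lagrangian (separable_sum f) Abar Bbar) x z \<nu>"
    and \<gamma>_pos: "\<gamma> > 0"
    and \<nu>0: "transpose Bbar *v \<nu>0 = 0"
  shows
    "(\<forall>x z \<nu>. admm_iterates (separable_sum f) Abar Bbar \<gamma> x z \<nu> \<and> \<nu> 0 = \<nu>0 \<longrightarrow>
        (\<forall>k. k > 0 \<or> z 0 = (matrix_inv De ** transpose Cbar) *v x 0 \<longrightarrow>
           reduced_x_step (separable_sum f) Dv De Cbar \<gamma>
             (x k) (transpose Abar *v \<nu> k) (x (Suc k))) \<and>
        (\<forall>k. reduced_y_step Dv De Cbar \<gamma>
             (transpose Abar *v \<nu> k) (x (Suc k)) (transpose Abar *v \<nu> (Suc k)))) \<and>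
     (\<forall>x y. y 0 = transpose Abar *v \<nu>0 \<and>
        (\<forall>k. reduced_x_step (separable_sum f) Dv De Cbar \<gamma> (x k) (y k) (x (Suc k)) \<and>
             reduced_y_step Dv De Cbar \<gamma> (y k) (x (Suc k)) (y (Suc k))) \<longrightarrow>
        (\<exists>z \<nu>. admm_iterates (separable_sum f) Abar Bbar \<gamma> x z \<nu> \<and> \<nu> 0 = \<nu>0 \<and>
           z 0 = (matrix_inv De ** transpose Cbar) *v x 0 \<and>
           (\<forall>k. y k = transpose Abar *v \<nu> k))) \<and>
     (\<forall>x y. \<exists>!x'. reduced_x_step (separable_sum f) Dv De Cbar \<gamma> x y x')"
proof -
  let ?F = "separable_sum f"
  \<comment> \<open>\<open>P\<close> sends an x-iterate to the z-iterate produced from it by the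
    z-step.\<close>
  define P where "P = matrix_inv De ** transpose Cbar"
  have "surj (\<lambda>k. fst (e k))"
    unfolding surj_def
  proof
    fix i
    obtain j where "i \<in> E j" using groups_cover by auto
    then have "(i, j) \<in> range e" using edges by (auto simp: bij_betw_def)
    then show "\<exists>k. i = fst (e k)" by (metis fst_conv imageE)
  qed
  then have A: "inj ((*v) Abar)"
    unfolding Abar node_matrix_def by (rule inj_kronecker_weighted_selection[OF S_diagonal S_nonzero])
  have "surj (\<lambda>k. snd (e k))"
    unfolding surj_def
  proof
    fix j
    obtain i where "i \<in> E j" using groups_nonempty by auto
    then have "(i, j) \<in> range e" using edges by (auto simp: bij_betw_def)
    then show "\<exists>k. j = snd (e k)" by (metis snd_conv imageE)
  qed
  then have B: "inj ((*v) Bbar)"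
    unfolding Bbar group_matrix_def by (rule inj_kronecker_weighted_selection[OF S_diagonal S_nonzero])

  have z_step: "is_arg_min (\<lambda>w. augmented_lagrangian ?F Abar Bbar \<gamma> x w \<nu>) (\<lambda>_. True) w \<longleftrightarrow>
      w = P *v x" if "transpose Bbar *v \<nu> = 0" for x w \<nu>
    using admm_z_step_iff[OF B \<gamma>_pos that] unfolding P_def De Cbar .
  have orth: "transpose Bbar *v (\<nu> + \<gamma> *\<^sub>R (Abar *v x - Bbar *v (P *v x))) = 0"
    if "transpose Bbar *v \<nu> = 0" for x \<nu>
    using multiplier_update_orthogonal[OF B that] unfolding P_def De Cbar .
  have x_step: "is_arg_min (\<lambda>u. augmented_lagrangian ?F Abar Bbar \<gamma> u (P *v x) \<nu>) (\<lambda>_. True) x' \<longleftrightarrow>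
      reduced_x_step ?F Dv De Cbar \<gamma> x (transpose Abar *v \<nu>) x'" for x x' \<nu>
    using admm_x_step_iff_reduced_x_step[OF refl Cbar] unfolding P_def Dv .
  have y_step: "reduced_y_step Dv De Cbar \<gamma> (transpose Abar *v \<nu>) x y' \<longleftrightarrow>
      y' = transpose Abar *v (\<nu> + \<gamma> *\<^sub>R (Abar *v x - Bbar *v (P *v x)))" for x y' \<nu>
    using reduced_y_step_multiplier_update[OF Cbar] unfolding P_def Dv .

  have reduces: "(\<forall>k. k > 0 \<or> z 0 = P *v x 0 \<longrightarrow>
          reduced_x_step ?F Dv De Cbar \<gamma> (x k) (transpose Abar *v \<nu> k) (x (Suc k))) \<and>
        (\<forall>k. reduced_y_step Dv De Cbar \<gamma>
          (transpose Abar *v \<nu> k) (x (Suc k)) (transpose Abar *v \<nu> (Suc k)))"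
    if admm: "admm_iterates ?F Abar Bbar \<gamma> x z \<nu>" and init: "\<nu> 0 = \<nu>0" for x z \<nu>
  proof -
    have xs: "is_arg_min (\<lambda>u. augmented_lagrangian ?F Abar Bbar \<gamma> u (z k) (\<nu> k)) (\<lambda>_. True) (x (Suc k))"
      and zs: "is_arg_min (\<lambda>w. augmented_lagrangian ?F Abar Bbar \<gamma> (x (Suc k)) w (\<nu> k)) (\<lambda>_. True) (z (Suc k))"
      and ns: "\<nu> (Suc k) = \<nu> k + \<gamma> *\<^sub>R (Abar *v x (Suc k) - Bbar *v z (Suc k))" for k
      using admm unfolding admm_iterates_def by blast+
    \<comment> \<open>Orthogonality of \<open>\<nu> k\<close> determines \<open>z (Suc k)\<close>
      through \<open>z_step\<close>, and that value makes \<open>\<nu> (Suc k)\<close> orthogonal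
      again.\<close>
    have nu: "transpose Bbar *v \<nu> k = 0" for k
    proof (induction k)
      case 0
      show ?case using \<nu>0 init by simp
    next
      case (Suc k)
      have "z (Suc k) = P *v x (Suc k)" using zs[of k] unfolding z_step[OF Suc] .
      then show ?case using orth[OF Suc] by (simp only: ns)
    qed
    have z: "z (Suc k) = P *v x (Suc k)" for k using zs[of k] unfolding z_step[OF nu] .
    \<comment> \<open>At index 0 there is no preceding z-step, so the relation must come from the
      initial data.\<close>
    have "z k = P *v x k" if "k > 0 \<or> z 0 = P *v x 0" for k
      using that z by (cases k) auto
    then show ?thesis using xs unfolding y_step ns z by (metis x_step)
  qed
  have lifts: "\<exists>z \<nu>. admm_iterates ?F Abar Bbar \<gamma> x z \<nu> \<and> \<nu> 0 = \<nu>0 \<and>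
      z 0 = P *v x 0 \<and> (\<forall>k. y k = transpose Abar *v \<nu> k)"
    if y0: "y 0 = transpose Abar *v \<nu>0"
      and steps: "\<And>k. reduced_x_step ?F Dv De Cbar \<gamma> (x k) (y k) (x (Suc k))"
        "\<And>k. reduced_y_step Dv De Cbar \<gamma> (y k) (x (Suc k)) (y (Suc k))" for x y
  proof -
    define z where "z = (\<lambda>k. P *v x k)"
    \<comment> \<open>The sequence \<open>y\<close> records only
      \<open>transpose Abar *v \<nu> k\<close>, so the multipliers are rebuilt by running the ADMM
      update from \<open>\<nu>0\<close> along the given \<open>x\<close>.\<close>
    define \<nu> where "\<nu> = rec_nat \<nu>0 (\<lambda>k v. v + \<gamma> *\<^sub>R (Abar *v x (Suc k) - Bbar *v z (Suc k)))"
    have rec: "\<nu> 0 = \<nu>0"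
      "\<nu> (Suc k) = \<nu> k + \<gamma> *\<^sub>R (Abar *v x (Suc k) - Bbar *v (P *v x (Suc k)))" for k
      by (simp_all add: \<nu>_def z_def)
    have nu: "transpose Bbar *v \<nu> k = 0" for k
      by (induction k) (simp_all only: rec \<nu>0 orth)
    have y: "y k = transpose Abar *v \<nu> k" for k
    proof (induction k)
      case (Suc k)
      then show ?case using steps(2)[of k] by (simp only: y_step rec)
    qed (simp only: y0 rec)
    have "admm_iterates ?F Abar Bbar \<gamma> x z \<nu>"
      unfolding admm_iterates_def z_def z_step[OF nu] x_step rec(2)
      by (intro allI conjI refl steps(1)[unfolded y])
    moreover have "z 0 = P *v x 0" by (simp only: z_def)
    ultimately show ?thesis using rec(1) y by (intro exI[of _ z] exI[of _ \<nu>] conjI allI)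
  qed
  have solvable: "\<exists>!x'. reduced_x_step ?F Dv De Cbar \<gamma> x y x'" for x y
  proof -
    obtain c d where minorant: "\<And>u. ?F u \<ge> c + u \<bullet> d"
      using saddle saddle_point_affine_minorant by metis
    \<comment> \<open>This turns the quadratic form of the reduced objective into the squared norm
      required for unique minimization.\<close>
    have "u \<bullet> (Dv *v u) = (norm (Abar *v u))\<^sup>2" for u
      by (simp only: Dv matrix_vector_mul_assoc[symmetric] inner_matrix_vector_mult_transpose
          transpose_transpose power2_norm_eq_inner)
    then show ?thesis
      using ex1_arg_min_convex_plus_quadratic[OF f_convex A \<gamma>_pos minorant]
      unfolding reduced_x_step_def by simp
  qed
  show ?thesis
    unfolding P_def[symmetric]
  proof (rule conjI)
    show "\<forall>x z \<nu>. admm_iterates ?F Abar Bbar \<gamma> x z \<nu> \<and> \<nu> 0 = \<nu>0 \<longrightarrow>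
        (\<forall>k. k > 0 \<or> z 0 = P *v x 0 \<longrightarrow>
          reduced_x_step ?F Dv De Cbar \<gamma> (x k) (transpose Abar *v \<nu> k) (x (Suc k))) \<and>
        (\<forall>k. reduced_y_step Dv De Cbar \<gamma>
          (transpose Abar *v \<nu> k) (x (Suc k)) (transpose Abar *v \<nu> (Suc k)))"
      by (intro allI impI, elim conjE, rule reduces)
  next
    show "(\<forall>x y. y 0 = transpose Abar *v \<nu>0 \<and>
        (\<forall>k. reduced_x_step ?F Dv De Cbar \<gamma> (x k) (y k) (x (Suc k)) \<and>
             reduced_y_step Dv De Cbar \<gamma> (y k) (x (Suc k)) (y (Suc k))) \<longrightarrow>
        (\<exists>z \<nu>. admm_iterates ?F Abar Bbar \<gamma> x z \<nu> \<and> \<nu> 0 = \<nu>0 \<and>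
           z 0 = P *v x 0 \<and> (\<forall>k. y k = transpose Abar *v \<nu> k))) \<and>
      (\<forall>x y. \<exists>!x'. reduced_x_step ?F Dv De Cbar \<gamma> x y x')"
      by (intro conjI[of "All _"] allI impI solvable, elim conjE, rule lifts) simp_all
  qed
qed

end
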